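(* Let $\mathcal{H}$ be a real Hilbert space, let $(x^k)_{k\in\mathbb{N}}$ be a sequence in $\mathcal{H}$ and let $M$ be a nonempty subset of $\mathcal{H}$. Suppose that $(x^k)_{k\in\mathbb{N}}$ is Fejér* monotone with respect to $M$. Then the following statements are equivalent: (i) $(x^k)_{k\in\mathbb{N}}$ converges strongly to a point in $M$; (ii) $\mathfrak{W}(x^k)_{k\in\mathbb{N}}\subset M$ and $\mathfrak{S}(x^k)_{k\in\mathbb{N}}\neq\emptyset$; (iii) $\mathfrak{S}(x^k)_{k\in\mathbb{N}}\cap M\neq\emptyset$.
   Context: $\mathbb{N}$ denotes the set of nonnegative integers. A sequence $(x^k)_{k\in\mathbb{N}}$ in a real Hilbert space $\mathcal{H}$ is Fejér* monotone with respect to a nonempty set $M\subset\mathcal{H}$ if for every $x\in M$ there exists $N(x)\in\mathbb{N}$ such that $\|x^{k+1}-x\|\le\|x^k-x\|$ for all $k\ge N(x)$. $\mathfrak{W}(x^k)_{k\in\mathbb{N}}$ denotes the set of weak cluster points of the sequence (weak limits of its weakly convergent subsequences) and $\mathfrak{S}(x^k)_{k\in\mathbb{N}}$ the set of its strong cluster points (norm limits of its norm-convergent subsequences). *)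

theory Defs
  imports "HOL-Analysis.Analysis"
begin

text \<open>A real Hilbert space is a type of sort \<open>{real_inner, complete_space}\<close>.\<close>

definition fejer_star_monotone :: "(nat \<Rightarrow> 'a::real_inner) \<Rightarrow> 'a set \<Rightarrow> bool" where
  "fejer_star_monotone x M \<longleftrightarrow>
     (\<forall>p\<in>M. \<exists>N. \<forall>k\<ge>N. norm (x (Suc k) - p) \<le> norm (x k - p))"

text \<open>Sequential convergence in the weak topology, the coarsest topology that makes every
  continuous linear functional continuous.\<close>

definition weakly_converges_to :: "(nat \<Rightarrow> 'a::real_normed_vector) \<Rightarrow> 'a \<Rightarrow> bool" where
  "weakly_converges_to x l \<longleftrightarrow>
     (\<forall>f::'a \<Rightarrow> real. bounded_linear f \<longrightarrow> (\<lambda>k. f (x k)) \<longlonglongrightarrow> f l)"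

definition weak_cluster_points :: "(nat \<Rightarrow> 'a::real_normed_vector) \<Rightarrow> 'a set" where
  "weak_cluster_points x =
     {l. \<exists>r::nat \<Rightarrow> nat. strict_mono r \<and> weakly_converges_to (x \<circ> r) l}"

definition strong_cluster_points :: "(nat \<Rightarrow> 'a::real_normed_vector) \<Rightarrow> 'a set" where
  "strong_cluster_points x =
     {l. \<exists>r::nat \<Rightarrow> nat. strict_mono r \<and> (x \<circ> r) \<longlonglongrightarrow> l}"

end

theory Submission
  imports Defs
begin

text \<open>Fejer* monotonicity makes the distance from the sequence to each fixed point of \<open>M\<close>
  eventually nonincreasing. If a point \<open>p\<close> of \<open>M\<close> is a strong cluster point, this distance also
  becomes arbitrarily small along a subsequence, so it tends to \<open>0\<close> and the whole sequence
  converges to \<open>p\<close> (\<open>fejer_star_LIMSEQ_cluster_point\<close>). The remaining implications compare the two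
  topologies: a strong cluster point is a weak one, and a norm-convergent sequence has its limit as
  only weak cluster point, because weak limits are unique.\<close>

lemma LIMSEQ_imp_weakly_converges_to:
  assumes "x \<longlonglongrightarrow> l"
  shows "weakly_converges_to x l"
  unfolding weakly_converges_to_def
  by (intro allI impI bounded_linear.tendsto[OF _ assms])

text \<open>The functional \<open>inner (l - m)\<close> separates two distinct candidate limits.\<close>

lemma weak_limit_unique:
  fixes x :: "nat \<Rightarrow> 'a::real_inner"
  assumes "weakly_converges_to x l" and "weakly_converges_to x m"
  shows "l = m"
proof -
  have "(\<lambda>k. inner (l - m) (x k)) \<longlonglongrightarrow> inner (l - m) l"
    and "(\<lambda>k. inner (l - m) (x k)) \<longlonglongrightarrow> inner (l - m) m"
    using assms bounded_linear_inner_right[of "l - m"]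
    unfolding weakly_converges_to_def by simp_all
  then have "inner (l - m) l = inner (l - m) m"
    by (rule LIMSEQ_unique)
  then have "inner (l - m) (l - m) = 0"
    by (simp add: inner_diff_right)
  then show ?thesis
    by simp
qed

lemma strong_cluster_points_subset_weak:
  "strong_cluster_points x \<subseteq> weak_cluster_points x"
  unfolding strong_cluster_points_def weak_cluster_points_def
  using LIMSEQ_imp_weakly_converges_to by blast

lemma LIMSEQ_imp_mem_strong_cluster_points:
  assumes "x \<longlonglongrightarrow> p"
  shows "p \<in> strong_cluster_points x"
proof -
  have "strict_mono (id :: nat \<Rightarrow> nat)" and "(x \<circ> id) \<longlonglongrightarrow> p"
    using assms by (simp_all add: strict_mono_id)
  then show ?thesis
    unfolding strong_cluster_points_def by blast
qed

lemma LIMSEQ_imp_weak_cluster_points_eq: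
  fixes x :: "nat \<Rightarrow> 'a::real_inner"
  assumes "x \<longlonglongrightarrow> p"
  shows "weak_cluster_points x = {p}"
proof
  show "weak_cluster_points x \<subseteq> {p}"
  proof
    fix l assume "l \<in> weak_cluster_points x"
    then obtain r where r: "strict_mono r" "weakly_converges_to (x \<circ> r) l"
      unfolding weak_cluster_points_def by blast
    have "weakly_converges_to (x \<circ> r) p"
      using LIMSEQ_subseq_LIMSEQ[OF assms r(1)] by (rule LIMSEQ_imp_weakly_converges_to)
    with r(2) show "l \<in> {p}"
      using weak_limit_unique by blast
  qed
  show "{p} \<subseteq> weak_cluster_points x"
    using LIMSEQ_imp_mem_strong_cluster_points[OF assms] strong_cluster_points_subset_weak
    by blast
qed

text \<open>Once the sequence is within \<open>e\<close> of \<open>p\<close> at an index beyond which the distance to \<open>p\<close> no longer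
  grows, it stays there; the subsequence provides such an index for every \<open>e\<close>.\<close>

lemma fejer_star_LIMSEQ_cluster_point:
  fixes x :: "nat \<Rightarrow> 'a::real_inner"
  assumes "fejer_star_monotone x M" and "p \<in> M" and "p \<in> strong_cluster_points x"
  shows "x \<longlonglongrightarrow> p"
proof (rule LIMSEQ_I)
  fix e :: real
  assume "0 < e"
  obtain N where N: "\<And>k. k \<ge> N \<Longrightarrow> norm (x (Suc k) - p) \<le> norm (x k - p)"
    using assms(1,2) unfolding fejer_star_monotone_def by blast
  obtain r where r: "strict_mono r" "(x \<circ> r) \<longlonglongrightarrow> p"
    using assms(3) unfolding strong_cluster_points_def by blast
  obtain n\<^sub>0 where "\<And>n. n \<ge> n\<^sub>0 \<Longrightarrow> norm ((x \<circ> r) n - p) < e"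
    using LIMSEQ_D[OF r(2) \<open>0 < e\<close>] by blast
  then have close: "norm (x (r (max N n\<^sub>0)) - p) < e"
    by simp
  have late: "N \<le> r (max N n\<^sub>0)"
    using seq_suble[OF r(1), of "max N n\<^sub>0"] by simp
  have "norm (x k - p) < e" if "k \<ge> r (max N n\<^sub>0)" for k
    using that
  proof (induction k rule: dec_induct)
    case base
    show ?case by (rule close)
  next
    case (step k)
    then show ?case
      using N[of k] late by linarith
  qed
  then show "\<exists>no. \<forall>k\<ge>no. norm (x k - p) < e"
    by blast
qed

theorem theorem4p7:
  fixes x :: "nat \<Rightarrow> 'a::{real_inner, complete_space}"
    and M :: "'a set"
  assumes "M \<noteq> {}"
    and "fejer_star_monotone x M"
  shows "((\<exists>p\<in>M. x \<longlonglongrightarrow> p) \<longleftrightarrow>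
           (weak_cluster_points x \<subseteq> M \<and> strong_cluster_points x \<noteq> {})) \<and>
         ((weak_cluster_points x \<subseteq> M \<and> strong_cluster_points x \<noteq> {}) \<longleftrightarrow>
           strong_cluster_points x \<inter> M \<noteq> {})"
proof -
  have "weak_cluster_points x \<subseteq> M \<and> strong_cluster_points x \<noteq> {}"
    if "\<exists>p\<in>M. x \<longlonglongrightarrow> p"
  proof -
    from that obtain p where "p \<in> M" and lim: "x \<longlonglongrightarrow> p"
      by blast
    then show ?thesis
      using LIMSEQ_imp_weak_cluster_points_eq[OF lim] LIMSEQ_imp_mem_strong_cluster_points[OF lim]
      by auto
  qed
  moreover have "strong_cluster_points x \<inter> M \<noteq> {}"
    if "weak_cluster_points x \<subseteq> M \<and> strong_cluster_points x \<noteq> {}"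
    using that strong_cluster_points_subset_weak[of x] by auto
  moreover have "\<exists>p\<in>M. x \<longlonglongrightarrow> p"
    if "strong_cluster_points x \<inter> M \<noteq> {}"
  proof -
    from that obtain p where "p \<in> M" and "p \<in> strong_cluster_points x"
      by blast
    then show ?thesis
      using fejer_star_LIMSEQ_cluster_point[OF assms(2)] by auto
  qed
  ultimately show ?thesis
    by blast
qed

end
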